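(* Let $G$ be a group acting on a set $\Omega$, let $F$ be a field, and let $V$ be a witness to $\mathrm{LinDim}_F(G,\Omega)$. Then $V$ is (as an $FG$-module) a quotient of the permutation module $F^\Omega$.
   Context: A representation over $F$ of the action of $G$ on $\Omega$ is a pair $(\rho,\varphi)$ where, for some $F$-vector space $V$, $\rho:G\to \mathrm{GL}(V)$ is a homomorphism and $\varphi:\Omega\to V$ is injective with $(\omega^g)\varphi=(\omega\varphi)^{g\rho}$ for all $\omega\in\Omega$, $g\in G$ (maps written on the right); $V$ is said to afford $(\rho,\varphi)$ and is an $FG$-module via $\rho$. $\mathrm{LinDim}_F(G,\Omega)$ is the minimum of $\dim V$ over all $V$ affording such a representation, and a witness is a $V$ affording a representation $(\rho,\varphi)$ with $\dim V=\mathrm{LinDim}_F(G,\Omega)$, regarded as an $FG$-module via that $\rho$. The permutation module $F^\Omega$ is the $F$-vector space with basis $\{e_\omega\mid\omega\in\Omega\}$ and action $(e_\omega)^g=e_{\omega^g}$.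
   Formalization: LinDim_F(G,Ω) is assumed finite; with infinite dimensions the claim fails, e.g. for G = FSym(ℕ) on Ω = ℕ, V = F^Ω plus a trivial module of countably infinite dimension is a witness but not a quotient of F^Ω. *)

theory Defs
  imports
    "HOL-Algebra.AbelCoset"
    "HOL-Algebra.Group_Action"
    "HOL-Library.Extended_Nat"
    "Jordan_Normal_Form.Missing_VectorSpace"
begin

text \<open>
  Actions are left actions, as in \<^locale>\<open>group_action\<close>: \<open>\<alpha> g \<omega>\<close> stands for
  \<open>\<omega>\<^sup>g\<close>, and \<open>\<rho> g v\<close> for the image of \<open>v\<close> under \<open>\<rho> g\<close>.  A vector space is a module
  record, whose \<open>mult\<close> and \<open>one\<close> fields carry no information.
\<close>

definition GL :: "('k, 'c) ring_scheme \<Rightarrow> ('k, 'v) module \<Rightarrow> ('v \<Rightarrow> 'v) monoid"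
  where "GL K V =
    (BijGroup (carrier V)) \<lparr>carrier := {T \<in> Bij (carrier V). linear_map K V V T}\<rparr>"


subsection \<open>Linear representations of an action\<close>

definition affords ::
    "('k, 'c) ring_scheme \<Rightarrow> ('g, 'd) monoid_scheme \<Rightarrow> 'o set \<Rightarrow> ('g \<Rightarrow> 'o \<Rightarrow> 'o) \<Rightarrow>
     ('k, 'v) module \<Rightarrow> ('g \<Rightarrow> 'v \<Rightarrow> 'v) \<Rightarrow> ('o \<Rightarrow> 'v) \<Rightarrow> bool"
  where "affords K G \<Omega> \<alpha> V \<rho> \<phi> \<longleftrightarrow>
    vectorspace K V \<and> \<rho> \<in> hom G (GL K V) \<and>
    \<phi> \<in> \<Omega> \<rightarrow> carrier V \<and> inj_on \<phi> \<Omega> \<and>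
    (\<forall>g \<in> carrier G. \<forall>\<omega> \<in> \<Omega>. \<phi> (\<alpha> g \<omega>) = \<rho> g (\<phi> \<omega>))"

text \<open>
  \<^const>\<open>vectorspace.dim\<close> is meaningful only for finite-dimensional spaces.  All infinite
  dimensions are identified here, so a witness is a space of least dimension only when
  \<open>lin_dim\<close> below is finite.
\<close>

definition vdim :: "('k, 'c) ring_scheme \<Rightarrow> ('k, 'v) module \<Rightarrow> enat"
  where "vdim K V =
    (if vectorspace.fin_dim K V then enat (vectorspace.dim K V) else \<infinity>)"

text \<open>
  The minimum is taken over the spaces whose vectors are functions from the type of \<open>\<Omega>\<close> to
  that of \<open>K\<close>.  This is no restriction: the permutation module is such a space and affords a
  representation, and every space of dimension at most \<open>|\<Omega>|\<close> is isomorphic to a subspace of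
  it, so all dimensions that can be minimal occur.
\<close>

definition lin_dim ::
    "('k, 'c) ring_scheme \<Rightarrow> ('g, 'd) monoid_scheme \<Rightarrow> 'o set \<Rightarrow> ('g \<Rightarrow> 'o \<Rightarrow> 'o) \<Rightarrow> enat"
  where "lin_dim K G \<Omega> \<alpha> =
    Inf {vdim K V |(V :: ('k, 'o \<Rightarrow> 'k) module) \<rho> \<phi>. affords K G \<Omega> \<alpha> V \<rho> \<phi>}"

definition witness ::
    "('k, 'c) ring_scheme \<Rightarrow> ('g, 'd) monoid_scheme \<Rightarrow> 'o set \<Rightarrow> ('g \<Rightarrow> 'o \<Rightarrow> 'o) \<Rightarrow>
     ('k, 'v) module \<Rightarrow> ('g \<Rightarrow> 'v \<Rightarrow> 'v) \<Rightarrow> bool"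
  where "witness K G \<Omega> \<alpha> V \<rho> \<longleftrightarrow>
    (\<exists>\<phi>. affords K G \<Omega> \<alpha> V \<rho> \<phi>) \<and> vdim K V = lin_dim K G \<Omega> \<alpha>"


subsection \<open>The permutation module\<close>

text \<open>
  \<open>\<Omega>\<close> may be infinite, so the space with basis \<open>e\<^sub>\<omega>\<close>, \<open>\<omega> \<in> \<Omega>\<close>, consists of the
  functions of finite support.
\<close>

definition perm_module :: "('k, 'c) ring_scheme \<Rightarrow> 'o set \<Rightarrow> ('k, 'o \<Rightarrow> 'k) module"
  where "perm_module K \<Omega> = (ring.func_space K \<Omega>)
    \<lparr>carrier := {f \<in> \<Omega> \<rightarrow>\<^sub>E carrier K. finite {\<omega> \<in> \<Omega>. f \<omega> \<noteq> \<zero>\<^bsub>K\<^esub>}}\<rparr>"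

definition perm_basis :: "('k, 'c) ring_scheme \<Rightarrow> 'o set \<Rightarrow> 'o \<Rightarrow> 'o \<Rightarrow> 'k"
  where "perm_basis K \<Omega> \<omega> = (\<lambda>\<omega>' \<in> \<Omega>. if \<omega>' = \<omega> then \<one>\<^bsub>K\<^esub> else \<zero>\<^bsub>K\<^esub>)"

text \<open>The linear extension of \<open>e\<^sub>\<omega> \<mapsto> e\<^bsub>\<alpha> g \<omega>\<^esub>\<close>, see \<open>perm_action_basis\<close> below.\<close>

definition perm_action ::
    "('k, 'c) ring_scheme \<Rightarrow> ('g, 'd) monoid_scheme \<Rightarrow> 'o set \<Rightarrow> ('g \<Rightarrow> 'o \<Rightarrow> 'o) \<Rightarrow>
     'g \<Rightarrow> ('o \<Rightarrow> 'k) \<Rightarrow> ('o \<Rightarrow> 'k)"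
  where "perm_action K G \<Omega> \<alpha> g =
    (\<lambda>f \<in> carrier (perm_module K \<Omega>). \<lambda>\<omega> \<in> \<Omega>. f (\<alpha> (inv\<^bsub>G\<^esub> g) \<omega>))"

lemma perm_basis_closed:
  assumes "ring K" "\<omega> \<in> \<Omega>"
  shows "perm_basis K \<Omega> \<omega> \<in> carrier (perm_module K \<Omega>)"
proof -
  interpret ring K by fact
  have "{\<omega>' \<in> \<Omega>. perm_basis K \<Omega> \<omega> \<omega>' \<noteq> \<zero>\<^bsub>K\<^esub>} \<subseteq> {\<omega>}"
    by (auto simp: perm_basis_def)
  then have "finite {\<omega>' \<in> \<Omega>. perm_basis K \<Omega> \<omega> \<omega>' \<noteq> \<zero>\<^bsub>K\<^esub>}"
    using finite_subset by blast
  then show ?thesis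
    by (auto simp: perm_module_def perm_basis_def)
qed

lemma perm_action_basis:
  assumes "ring K" "group_action G \<Omega> \<alpha>" "g \<in> carrier G" "\<omega> \<in> \<Omega>"
  shows "perm_action K G \<Omega> \<alpha> g (perm_basis K \<Omega> \<omega>) = perm_basis K \<Omega> (\<alpha> g \<omega>)"
proof -
  interpret group_action G \<Omega> \<alpha> by fact
  interpret G: group G using group_hom group_hom.axioms(1) by blast
  have "\<alpha> (inv\<^bsub>G\<^esub> g) \<omega>' \<in> \<Omega>" if "\<omega>' \<in> \<Omega>" for \<omega>'
    using that assms(3) element_image by blast
  moreover have "\<alpha> (inv\<^bsub>G\<^esub> g) \<omega>' = \<omega> \<longleftrightarrow> \<omega>' = \<alpha> g \<omega>" if "\<omega>' \<in> \<Omega>" for \<omega>'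
    using that assms(3,4) orbit_sym_aux by (metis G.inv_closed G.inv_inv)
  ultimately show ?thesis
    using perm_basis_closed[OF assms(1,4)]
    by (auto simp: perm_action_def perm_basis_def fun_eq_iff)
qed


subsection \<open>Quotients of \<open>KG\<close>-modules\<close>

text \<open>A \<open>KG\<close>-module is a space \<open>V\<close> together with a homomorphism \<open>\<rho>\<close> from \<open>G\<close> to \<open>GL K V\<close>.\<close>

definition fg_submodule ::
    "('k, 'c) ring_scheme \<Rightarrow> ('g, 'd) monoid_scheme \<Rightarrow>
     ('k, 'v) module \<Rightarrow> ('g \<Rightarrow> 'v \<Rightarrow> 'v) \<Rightarrow> 'v set \<Rightarrow> bool"
  where "fg_submodule K G V \<rho> N \<longleftrightarrow>
    subspace K N V \<and> (\<forall>g \<in> carrier G. \<forall>v \<in> N. \<rho> g v \<in> N)"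

text \<open>
  In the scalar multiplication, \<open>N\<close> has to be added because \<open>a X\<close> is not a full coset of \<open>N\<close>
  when \<open>a = 0\<close>.
\<close>

definition quot_module :: "('k, 'v) module \<Rightarrow> 'v set \<Rightarrow> ('k, 'v set) module"
  where "quot_module V N =
    \<lparr>carrier = a_rcosets\<^bsub>V\<^esub> N, mult = (\<lambda>X Y. N), one = N, zero = N,
     add = (\<lambda>X Y. X <+>\<^bsub>V\<^esub> Y),
     smult = (\<lambda>a X. N <+>\<^bsub>V\<^esub> ((\<lambda>x. a \<odot>\<^bsub>V\<^esub> x) ` X))\<rparr>"

definition quot_action ::
    "('k, 'v) module \<Rightarrow> ('g \<Rightarrow> 'v \<Rightarrow> 'v) \<Rightarrow> 'v set \<Rightarrow> 'g \<Rightarrow> 'v set \<Rightarrow> 'v set"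
  where "quot_action V \<rho> N g = (\<lambda>X \<in> a_rcosets\<^bsub>V\<^esub> N. \<rho> g ` X)"

definition fg_isomorphic ::
    "('k, 'c) ring_scheme \<Rightarrow> ('g, 'd) monoid_scheme \<Rightarrow>
     ('k, 'v) module \<Rightarrow> ('g \<Rightarrow> 'v \<Rightarrow> 'v) \<Rightarrow> ('k, 'w) module \<Rightarrow> ('g \<Rightarrow> 'w \<Rightarrow> 'w) \<Rightarrow> bool"
  where "fg_isomorphic K G V \<rho> W \<sigma> \<longleftrightarrow>
    (\<exists>T. linear_map K V W T \<and> bij_betw T (carrier V) (carrier W) \<and>
      (\<forall>g \<in> carrier G. \<forall>v \<in> carrier V. T (\<rho> g v) = \<sigma> g (T v)))"

text \<open>\<open>(V, \<rho>)\<close> is a quotient of \<open>(U, \<sigma>)\<close>.\<close>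

definition fg_quotient_of ::
    "('k, 'c) ring_scheme \<Rightarrow> ('g, 'd) monoid_scheme \<Rightarrow>
     ('k, 'v) module \<Rightarrow> ('g \<Rightarrow> 'v \<Rightarrow> 'v) \<Rightarrow> ('k, 'u) module \<Rightarrow> ('g \<Rightarrow> 'u \<Rightarrow> 'u) \<Rightarrow> bool"
  where "fg_quotient_of K G V \<rho> U \<sigma> \<longleftrightarrow>
    (\<exists>N. fg_submodule K G U \<sigma> N \<and>
      fg_isomorphic K G (quot_module U N) (quot_action U \<sigma> N) V \<rho>)"

end

theory Submission
  imports Defs
begin

text \<open>
  Let \<open>(\<rho>, \<phi>)\<close> be afforded by \<open>V\<close>.  The map \<open>\<phi>\<close> extends from the basis \<open>e\<^sub>\<omega>\<close> of the permutation
  module to a linear map \<open>perm_lift\<close> into \<open>V\<close>, which is equivariant because \<open>\<phi>\<close> is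
  (\<open>perm_lift_linear\<close>, \<open>perm_lift_equivariant\<close>).  Its image is the span of \<open>\<phi> ` \<Omega>\<close>, an
  invariant subspace that contains all \<open>\<phi> \<omega>\<close>.  Hence \<open>\<rho>\<close> restricts to it and, together with
  \<open>\<phi>\<close>, represents the action there (\<open>affords_invariant_subspace\<close>).

  If \<open>V\<close> is a witness and has finite dimension, then the image must be all of \<open>V\<close>, since a proper
  subspace would have smaller dimension (\<open>proper_subspace_fin_dim\<close>, \<open>perm_lift_surj\<close>).  So the
  permutation module maps onto \<open>V\<close>, and the first isomorphism theorem for \<open>KG\<close>-modules
  (\<open>fg_quotient_of_surjection\<close>) exhibits \<open>V\<close> as its quotient by the kernel.

  One point is peculiar to typed logic.  The minimum in \<open>lin_dim\<close> runs over spaces in a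
  fixed type of vectors, whereas \<open>V\<close> and its subspaces may live in any type.  The image of the lift
  is therefore copied into that type (\<open>affords_transport\<close>) along a right inverse of the lift.
\<close>


section \<open>Images, quotients and proper subspaces of vector spaces\<close>

lemma linear_map_iff:
  "linear_map K V W T \<longleftrightarrow>
    vectorspace K V \<and> vectorspace K W \<and> T \<in> module_hom K V W"
  unfolding linear_map_def mod_hom_def mod_hom_axioms_def vectorspace_def by auto

text \<open>
  The axioms of a vector space are equations together with closure conditions, so they pass along
  any surjection that respects the operations.  This covers quotient spaces, where the surjection
  is the projection, as well as copies of a space in another type, where it is a bijection.
\<close>

lemma linear_image_of_vectorspace:
  fixes V :: "('k, 'v) module" and Q :: "('k, 'q) module"
  assumes "vectorspace K V"
    and surj: "p ` carrier V = carrier Q"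
    and zero: "p \<zero>\<^bsub>V\<^esub> = \<zero>\<^bsub>Q\<^esub>"
    and add: "\<And>x y. x \<in> carrier V \<Longrightarrow> y \<in> carrier V \<Longrightarrow> p (x \<oplus>\<^bsub>V\<^esub> y) = p x \<oplus>\<^bsub>Q\<^esub> p y"
    and smult: "\<And>a x. a \<in> carrier K \<Longrightarrow> x \<in> carrier V \<Longrightarrow> p (a \<odot>\<^bsub>V\<^esub> x) = a \<odot>\<^bsub>Q\<^esub> p x"
  shows "linear_map K V Q p"
proof -
  interpret V: vectorspace K V by fact
  note ops = add[symmetric] smult[symmetric] zero[symmetric]
  have cl: "p x \<in> carrier Q" if "x \<in> carrier V" for x
    using surj that by blast
  have lift: "\<exists>x \<in> carrier V. q = p x" if "q \<in> carrier Q" for q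
    using surj that by blast
  have "vectorspace K Q"
  proof (rule vs_criteria)
    show "field K" by (rule V.field_axioms)
    show "\<zero>\<^bsub>Q\<^esub> \<in> carrier Q"
      using cl zero by (metis V.M.zero_closed)
    show "\<forall>v w. v \<in> carrier Q \<and> w \<in> carrier Q \<longrightarrow> v \<oplus>\<^bsub>Q\<^esub> w \<in> carrier Q"
      using cl lift add by (metis V.M.a_closed)
    show "\<forall>v \<in> carrier Q. \<exists>neg_v \<in> carrier Q. v \<oplus>\<^bsub>Q\<^esub> neg_v = \<zero>\<^bsub>Q\<^esub>"
      using cl lift add zero by (metis V.M.a_inv_closed V.M.r_neg)
    show "\<forall>c v. c \<in> carrier K \<and> v \<in> carrier Q \<longrightarrow> c \<odot>\<^bsub>Q\<^esub> v \<in> carrier Q"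
      using cl lift smult by (metis V.smult_closed)
    show "\<forall>v w. v \<in> carrier Q \<and> w \<in> carrier Q \<longrightarrow> v \<oplus>\<^bsub>Q\<^esub> w = w \<oplus>\<^bsub>Q\<^esub> v"
      using lift add by (metis V.M.a_comm)
    show "\<forall>v w x. v \<in> carrier Q \<and> w \<in> carrier Q \<and> x \<in> carrier Q \<longrightarrow>
        v \<oplus>\<^bsub>Q\<^esub> w \<oplus>\<^bsub>Q\<^esub> x = v \<oplus>\<^bsub>Q\<^esub> (w \<oplus>\<^bsub>Q\<^esub> x)"
      by (auto dest!: lift simp: ops V.M.a_assoc)
    show "\<forall>v \<in> carrier Q. v \<oplus>\<^bsub>Q\<^esub> \<zero>\<^bsub>Q\<^esub> = v"
      by (auto dest!: lift simp: ops)
    show "\<forall>a b v. a \<in> carrier K \<and> b \<in> carrier K \<and> v \<in> carrier Q \<longrightarrow>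
        (a \<otimes>\<^bsub>K\<^esub> b) \<odot>\<^bsub>Q\<^esub> v = a \<odot>\<^bsub>Q\<^esub> (b \<odot>\<^bsub>Q\<^esub> v)"
      by (auto dest!: lift simp: ops V.smult_assoc1)
    show "\<forall>v \<in> carrier Q. \<one>\<^bsub>K\<^esub> \<odot>\<^bsub>Q\<^esub> v = v"
      by (auto dest!: lift simp: ops)
    show "\<forall>a b v. a \<in> carrier K \<and> b \<in> carrier K \<and> v \<in> carrier Q \<longrightarrow>
        (a \<oplus>\<^bsub>K\<^esub> b) \<odot>\<^bsub>Q\<^esub> v = a \<odot>\<^bsub>Q\<^esub> v \<oplus>\<^bsub>Q\<^esub> b \<odot>\<^bsub>Q\<^esub> v"
      by (auto dest!: lift simp: ops V.smult_l_distr)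
    show "\<forall>a v w. a \<in> carrier K \<and> v \<in> carrier Q \<and> w \<in> carrier Q \<longrightarrow>
        a \<odot>\<^bsub>Q\<^esub> (v \<oplus>\<^bsub>Q\<^esub> w) = a \<odot>\<^bsub>Q\<^esub> v \<oplus>\<^bsub>Q\<^esub> a \<odot>\<^bsub>Q\<^esub> w"
      by (auto dest!: lift simp: ops V.smult_r_distr)
  qed
  then show ?thesis
    using cl add smult by (auto simp: linear_map_iff module_hom_def V.vectorspace_axioms)
qed

text \<open>
  A maximal independent subset \<open>A\<close> of \<open>S\<close> exists because independent sets have at most \<open>dim\<close>
  elements, and it spans \<open>S\<close>.  If it had \<open>dim\<close> elements, it would be a basis of the whole space.
\<close>

lemma (in vectorspace) proper_subspace_fin_dim:
  assumes fd: "fin_dim" and S: "subspace K S V" and ne: "S \<noteq> carrier V"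
  shows "vectorspace.fin_dim K (vs S)" "vectorspace.dim K (vs S) < dim"
proof -
  have sub: "submodule K S V" and SV: "S \<subseteq> carrier V"
    using S by (auto simp: subspace_def submodule_def)
  interpret S: vectorspace K "vs S" by (rule subspace_is_vs[OF S])
  define P where "P A \<longleftrightarrow> A \<subseteq> S \<and> lin_indpt A" for A
  have "P {}" by (auto simp: P_def lin_dep_def)
  moreover have "finite A \<and> card A \<le> dim" if "P A" for A
    using that li_le_dim[OF fd] SV by (auto simp: P_def)
  ultimately obtain A where A: "finite A" "maximal A P"
    using maximal_exists[of P dim "{}"] by blast
  then have AS: "A \<subseteq> S" and li: "lin_indpt A"
    by (auto simp: maximal_def P_def)
  have AV: "A \<subseteq> carrier V" using AS SV by blast
  have "v \<in> span A" if "v \<in> S" for v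
  proof (cases "v \<in> A")
    case True
    then show ?thesis using in_own_span[OF AV] by blast
  next
    case False
    have "\<not> P (A \<union> {v})" using A(2) False by (auto simp: maximal_def)
    then have "lin_dep (A \<union> {v})" using AS that by (auto simp: P_def)
    then show ?thesis
      using lin_dep_iff_in_span[OF AV li _ False] that SV by blast
  qed
  then have span: "span A = S"
    using span_is_subset[OF AS sub] by blast
  then have gen: "S.span A = S"
    using span_li_not_depend(1)[OF AS sub] by simp
  show "S.fin_dim"
    unfolding S.fin_dim_def using A(1) AS gen by auto
  have "S.dim \<le> card A"
    using S.gen_ge_dim A(1) AS gen by simp
  moreover have "card A < dim"
  proof (rule ccontr)
    assume "\<not> card A < dim"
    then have "basis A" using dim_li_is_basis[OF fd A(1) AV li] by simp
    then show False using span ne by (simp add: basis_def)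
  qed
  ultimately show "S.dim < dim" by simp
qed

lemma (in linear_map) T_finsum:
  assumes "f \<in> A \<rightarrow> carrier V"
  shows "T (\<Oplus>\<^bsub>V\<^esub>i \<in> A. f i) = (\<Oplus>\<^bsub>W\<^esub>i \<in> A. T (f i))"
  using assms
proof (induction A rule: infinite_finite_induct)
  case (insert i A)
  then have "T \<circ> f \<in> insert i A \<rightarrow> carrier W" by (auto simp: Pi_iff)
  with insert show ?case by (simp add: Pi_iff)
qed simp_all

lemma quot_module_projection:
  fixes U :: "('k, 'u) module"
  assumes "subspace K N U"
  shows "linear_map K U (quot_module U N) (\<lambda>u. N +>\<^bsub>U\<^esub> u)"
proof -
  have N: "submodule K N U" and vs: "vectorspace K U"
    using assms by (auto simp: subspace_def)
  interpret U: vectorspace K U by fact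
  interpret N: submodule K N U by fact
  have "subgroup N (add_monoid U)"
  proof (rule U.M.add.subgroupI)
    show "\<ominus>\<^bsub>U\<^esub> a \<in> N" if "a \<in> N" for a
    proof -
      have "(\<ominus>\<^bsub>K\<^esub> \<one>\<^bsub>K\<^esub>) \<odot>\<^bsub>U\<^esub> a \<in> N" using that by simp
      then show ?thesis using that N.subset U.smult_minus_1 by (metis subsetD)
    qed
  qed (use N.subset N.zero_closed N.m_closed in \<open>auto simp del: N.zero_closed\<close>)
  then interpret A: abelian_subgroup N U
    by (intro abelian_subgroupI3 additive_subgroupI U.M.abelian_group_axioms)
  show ?thesis
  proof (rule linear_image_of_vectorspace)
    show "vectorspace K U" by fact
    show "(\<lambda>u. N +>\<^bsub>U\<^esub> u) ` carrier U = carrier (quot_module U N)"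
      by (auto simp: quot_module_def A_RCOSETS_def')
    show "N +>\<^bsub>U\<^esub> \<zero>\<^bsub>U\<^esub> = \<zero>\<^bsub>quot_module U N\<^esub>"
      using N.subset by (simp add: quot_module_def)
    show "N +>\<^bsub>U\<^esub> (x \<oplus>\<^bsub>U\<^esub> y) = (N +>\<^bsub>U\<^esub> x) \<oplus>\<^bsub>quot_module U N\<^esub> (N +>\<^bsub>U\<^esub> y)"
      if "x \<in> carrier U" "y \<in> carrier U" for x y
      using that A.a_rcos_sum by (simp add: quot_module_def)
    show "N +>\<^bsub>U\<^esub> (a \<odot>\<^bsub>U\<^esub> x) = a \<odot>\<^bsub>quot_module U N\<^esub> (N +>\<^bsub>U\<^esub> x)"
      if a: "a \<in> carrier K" and x: "x \<in> carrier U" for a x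
    proof -
      (* An element of N + a (N + x) has the form n + a (m + x) and lies in the coset of a x;
         conversely n + a x is of this form with m = 0. *)
      have "\<exists>l \<in> N. n \<oplus>\<^bsub>U\<^esub> a \<odot>\<^bsub>U\<^esub> (m \<oplus>\<^bsub>U\<^esub> x) = l \<oplus>\<^bsub>U\<^esub> a \<odot>\<^bsub>U\<^esub> x" if "n \<in> N" "m \<in> N" for n m
        using that a x N.subset
        by (intro bexI[of _ "n \<oplus>\<^bsub>U\<^esub> a \<odot>\<^bsub>U\<^esub> m"]) (auto simp: U.smult_r_distr U.M.a_assoc subset_iff)
      moreover have "\<exists>m \<in> N. \<exists>l \<in> N. n \<oplus>\<^bsub>U\<^esub> a \<odot>\<^bsub>U\<^esub> x = m \<oplus>\<^bsub>U\<^esub> a \<odot>\<^bsub>U\<^esub> (l \<oplus>\<^bsub>U\<^esub> x)" if "n \<in> N" for n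
        using that x by (intro bexI[of _ n] bexI[of _ "\<zero>\<^bsub>U\<^esub>"]) auto
      ultimately show ?thesis
        by (force simp: quot_module_def set_add_def' a_r_coset_def')
    qed
  qed
qed


section \<open>Group representations\<close>

lemma in_hom_GL_iff:
  assumes "group G" "vectorspace K V"
  shows "\<rho> \<in> hom G (GL K V) \<longleftrightarrow>
    (\<forall>g \<in> carrier G. \<rho> g \<in> extensional (carrier V) \<and>
      bij_betw (\<rho> g) (carrier V) (carrier V) \<and> \<rho> g \<in> module_hom K V V) \<and>
    (\<forall>g \<in> carrier G. \<forall>h \<in> carrier G. \<forall>x \<in> carrier V. \<rho> (g \<otimes>\<^bsub>G\<^esub> h) x = \<rho> g (\<rho> h x))"
    (is "_ \<longleftrightarrow> ?A \<and> ?B")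
proof -
  interpret group G by fact
  have A: "\<rho> \<in> carrier G \<rightarrow> carrier (GL K V) \<longleftrightarrow> ?A"
    using assms(2) by (auto simp: GL_def BijGroup_def Bij_def linear_map_iff)
  have "?A \<Longrightarrow> (\<forall>g \<in> carrier G. \<forall>h \<in> carrier G. \<rho> (g \<otimes>\<^bsub>G\<^esub> h) = \<rho> g \<otimes>\<^bsub>GL K V\<^esub> \<rho> h) \<longleftrightarrow> ?B"
    (is "_ \<Longrightarrow> ?C \<longleftrightarrow> _")
  proof -
    assume ?A
    then have *: "\<rho> g \<otimes>\<^bsub>GL K V\<^esub> \<rho> h = compose (carrier V) (\<rho> g) (\<rho> h)"
      if "g \<in> carrier G" "h \<in> carrier G" for g h
      using that by (simp add: GL_def BijGroup_def Bij_def)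
    have ext: "\<rho> (g \<otimes>\<^bsub>G\<^esub> h) \<in> extensional (carrier V)"
      if "g \<in> carrier G" "h \<in> carrier G" for g h
      using \<open>?A\<close> that by simp
    show "?C \<longleftrightarrow> ?B"
      using ext by (auto simp: * compose_def fun_eq_iff extensional_def)
  qed
  then show ?thesis unfolding hom_def using A by blast
qed

lemma GL_homD:
  assumes "group G" "vectorspace K V" "\<rho> \<in> hom G (GL K V)" "g \<in> carrier G"
  shows "bij_betw (\<rho> g) (carrier V) (carrier V)" and "linear_map K V V (\<rho> g)"
    and "h \<in> carrier G \<Longrightarrow> x \<in> carrier V \<Longrightarrow> \<rho> (g \<otimes>\<^bsub>G\<^esub> h) x = \<rho> g (\<rho> h x)"
  using assms by (simp_all add: in_hom_GL_iff linear_map_iff)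

text \<open>An idempotent injection is the identity.\<close>

lemma GL_hom_one:
  assumes "group G" "vectorspace K V" "\<rho> \<in> hom G (GL K V)" "x \<in> carrier V"
  shows "\<rho> \<one>\<^bsub>G\<^esub> x = x"
proof -
  interpret group G by fact
  note \<rho> = GL_homD[OF assms(1-3) one_closed]
  have "\<rho> \<one>\<^bsub>G\<^esub> (\<rho> \<one>\<^bsub>G\<^esub> x) = \<rho> \<one>\<^bsub>G\<^esub> x"
    using \<rho>(3)[OF one_closed assms(4)] by simp
  then show ?thesis
    using \<rho>(1) assms(4) by (meson bij_betw_apply bij_betw_def inj_onD)
qed

text \<open>
  The first isomorphism theorem for \<open>KG\<close>-modules.  The map \<open>T\<close> is constant on each coset of its
  kernel, and each fibre is a single coset, so \<open>X \<mapsto> T ` X\<close> is a bijection onto singletons.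
  It intertwines the actions because \<open>T\<close> sends \<open>\<sigma> g ` X\<close> to the translate by \<open>\<rho> g\<close> of its
  value on \<open>X\<close>.
\<close>

lemma fg_quotient_of_surjection:
  fixes U :: "('k, 'u) module" and V :: "('k, 'v) module"
  assumes T: "linear_map K U V T"
    and surj: "T ` carrier U = carrier V"
    and \<sigma>: "\<And>g u. g \<in> carrier G \<Longrightarrow> u \<in> carrier U \<Longrightarrow> \<sigma> g u \<in> carrier U"
    and equiv: "\<And>g u. g \<in> carrier G \<Longrightarrow> u \<in> carrier U \<Longrightarrow> T (\<sigma> g u) = \<rho> g (T u)"
    and \<rho>0: "\<And>g. g \<in> carrier G \<Longrightarrow> \<rho> g \<zero>\<^bsub>V\<^esub> = \<zero>\<^bsub>V\<^esub>"
  shows "fg_quotient_of K G V \<rho> U \<sigma>"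
proof -
  interpret U: vectorspace K U using T by (simp add: linear_map_iff)
  interpret V: vectorspace K V using T by (simp add: linear_map_iff)
  interpret T: linear_map K U V T by fact
  define N where "N = {u \<in> carrier U. T u = \<zero>\<^bsub>V\<^esub>}"
  have N: "subspace K N U"
    using T.kerT_is_subspace unfolding T.ker_def N_def by simp
  have "fg_submodule K G U \<sigma> N"
    using N \<sigma> equiv \<rho>0 by (auto simp: fg_submodule_def N_def)
  interpret P: linear_map K U "quot_module U N" "\<lambda>u. N +>\<^bsub>U\<^esub> u"
    by (rule quot_module_projection[OF N])
  have carr: "carrier (quot_module U N) = (\<lambda>u. N +>\<^bsub>U\<^esub> u) ` carrier U"
    by (auto simp: quot_module_def A_RCOSETS_def')
  have coset: "N +>\<^bsub>U\<^esub> u = {x \<in> carrier U. T x = T u}" if u: "u \<in> carrier U" for u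
  proof (intro Set.set_eqI iffI)
    fix x assume "x \<in> N +>\<^bsub>U\<^esub> u"
    then show "x \<in> {x \<in> carrier U. T x = T u}"
      using u by (auto simp: N_def a_r_coset_def')
  next
    fix x assume x: "x \<in> {x \<in> carrier U. T x = T u}"
    then have "x \<ominus>\<^bsub>U\<^esub> u \<in> N" "x = (x \<ominus>\<^bsub>U\<^esub> u) \<oplus>\<^bsub>U\<^esub> u"
      using u by (auto simp: N_def U.M.a_assoc U.M.minus_eq U.M.l_neg V.M.r_neg)
    then show "x \<in> N +>\<^bsub>U\<^esub> u"
      by (auto simp: a_r_coset_def')
  qed
  define T' where "T' X = the_elem (T ` X)" for X
  have T'[simp]: "T' (N +>\<^bsub>U\<^esub> u) = T u" if "u \<in> carrier U" for u
  proof -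
    have "T ` (N +>\<^bsub>U\<^esub> u) = {T u}"
      using that by (auto simp: coset)
    then show ?thesis by (simp add: T'_def)
  qed
  have "T' \<in> module_hom K (quot_module U N) V"
    by (auto simp: module_hom_def carr simp flip: P.f_add P.f_smult)
  then have "linear_map K (quot_module U N) V T'"
    using P.W.vectorspace_axioms V.vectorspace_axioms by (simp add: linear_map_iff)
  moreover have "bij_betw T' (carrier (quot_module U N)) (carrier V)"
    unfolding bij_betw_def
  proof
    show "inj_on T' (carrier (quot_module U N))"
      by (auto simp: inj_on_def carr) (auto simp: coset)
    show "T' ` carrier (quot_module U N) = carrier V"
      unfolding carr surj[symmetric] image_image by (rule image_cong) auto
  qed
  moreover have "T' (quot_action U \<sigma> N g X) = \<rho> g (T' X)"
    if g: "g \<in> carrier G" and X: "X \<in> carrier (quot_module U N)" for g X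
  proof -
    obtain u where u: "u \<in> carrier U" "X = N +>\<^bsub>U\<^esub> u"
      using X carr by blast
    have "quot_action U \<sigma> N g X = \<sigma> g ` X"
      using X by (simp add: quot_action_def quot_module_def)
    moreover have "T ` \<sigma> g ` X = {\<rho> g (T u)}"
      using u g equiv by (auto simp: coset image_iff intro!: exI[of _ u])
    ultimately have "T' (quot_action U \<sigma> N g X) = \<rho> g (T u)"
      by (simp only: T'_def the_elem_eq)
    then show ?thesis using u by simp
  qed
  ultimately show ?thesis
    using \<open>fg_submodule K G U \<sigma> N\<close>
    unfolding fg_quotient_of_def fg_isomorphic_def by blast
qed


section \<open>The permutation module and maps out of it\<close>

lemma perm_module_vectorspace:
  assumes "field K"
  shows "vectorspace K (perm_module K \<Omega>)"
proof -
  interpret K: field K by fact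
  let ?F = "K.func_space \<Omega>"
  interpret F: module K ?F by (rule K.func_space_is_module)
  let ?N = "{f \<in> \<Omega> \<rightarrow>\<^sub>E carrier K. finite {\<omega> \<in> \<Omega>. f \<omega> \<noteq> \<zero>\<^bsub>K\<^esub>}}"
  have "submodule K ?N ?F"
  proof (rule submodule.intro)
    show "module K ?F" by (rule F.module_axioms)
    show "?N \<subseteq> carrier ?F" "\<zero>\<^bsub>?F\<^esub> \<in> ?N"
      by (auto simp: K.func_space_def)
    show "v \<oplus>\<^bsub>?F\<^esub> w \<in> ?N" if "v \<in> ?N" "w \<in> ?N" for v w
    proof -
      have "{\<omega> \<in> \<Omega>. v \<omega> \<oplus>\<^bsub>K\<^esub> w \<omega> \<noteq> \<zero>\<^bsub>K\<^esub>} \<subseteq> {\<omega> \<in> \<Omega>. v \<omega> \<noteq> \<zero>\<^bsub>K\<^esub>} \<union> {\<omega> \<in> \<Omega>. w \<omega> \<noteq> \<zero>\<^bsub>K\<^esub>}"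
        by auto
      then have "finite {\<omega> \<in> \<Omega>. v \<omega> \<oplus>\<^bsub>K\<^esub> w \<omega> \<noteq> \<zero>\<^bsub>K\<^esub>}"
        using that finite_subset by blast
      then show ?thesis using that by (auto simp: K.func_space_def cong: conj_cong)
    qed
    show "c \<odot>\<^bsub>?F\<^esub> v \<in> ?N" if "c \<in> carrier K" "v \<in> ?N" for c v
    proof -
      have "{\<omega> \<in> \<Omega>. c \<otimes>\<^bsub>K\<^esub> v \<omega> \<noteq> \<zero>\<^bsub>K\<^esub>} \<subseteq> {\<omega> \<in> \<Omega>. v \<omega> \<noteq> \<zero>\<^bsub>K\<^esub>}"
        using that by auto
      then have "finite {\<omega> \<in> \<Omega>. c \<otimes>\<^bsub>K\<^esub> v \<omega> \<noteq> \<zero>\<^bsub>K\<^esub>}"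
        using that finite_subset by blast
      then show ?thesis using that by (auto simp: K.func_space_def cong: conj_cong)
    qed
  qed
  then have "module K (perm_module K \<Omega>)"
    unfolding perm_module_def by (rule F.submodule_is_module)
  then show ?thesis
    by (simp add: vectorspace_def assms)
qed

text \<open>
  The linear extension of \<open>e\<^sub>\<omega> \<mapsto> \<phi> \<omega>\<close>, see \<open>perm_lift_basis\<close> below.  The sum is restricted to the
  support because \<open>\<Omega>\<close> may be infinite, and infinite sums take a default value.
\<close>

definition perm_lift :: "('k, 'c) ring_scheme \<Rightarrow> 'o set \<Rightarrow> ('k, 'v) module \<Rightarrow> ('o \<Rightarrow> 'v) \<Rightarrow>
    ('o \<Rightarrow> 'k) \<Rightarrow> 'v"
  where "perm_lift K \<Omega> V \<phi> f = (\<Oplus>\<^bsub>V\<^esub>\<omega> \<in> {\<omega> \<in> \<Omega>. f \<omega> \<noteq> \<zero>\<^bsub>K\<^esub>}. f \<omega> \<odot>\<^bsub>V\<^esub> \<phi> \<omega>)"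

text \<open>
  The support varies with \<open>f\<close>.  To compare the values at several arguments, all of them are written
  as sums over one finite set that contains every support involved.
\<close>

lemma perm_lift_superset:
  assumes "vectorspace K V" "\<phi> \<in> \<Omega> \<rightarrow> carrier V" "f \<in> \<Omega> \<rightarrow> carrier K"
    and "finite A" "A \<subseteq> \<Omega>" "{\<omega> \<in> \<Omega>. f \<omega> \<noteq> \<zero>\<^bsub>K\<^esub>} \<subseteq> A"
  shows "perm_lift K \<Omega> V \<phi> f = (\<Oplus>\<^bsub>V\<^esub>\<omega> \<in> A. f \<omega> \<odot>\<^bsub>V\<^esub> \<phi> \<omega>)"
proof -
  interpret V: vectorspace K V by fact
  show ?thesis
    unfolding perm_lift_def
    using assms(2-)
    by (intro V.M.add.finprod_mono_neutral_cong_left) (auto simp: Pi_iff subset_iff)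
qed

lemma perm_lift_linear:
  assumes "vectorspace K V" "\<phi> \<in> \<Omega> \<rightarrow> carrier V"
  shows "linear_map K (perm_module K \<Omega>) V (perm_lift K \<Omega> V \<phi>)"
proof -
  interpret V: vectorspace K V by fact
  let ?U = "perm_module K \<Omega>" and ?T = "perm_lift K \<Omega> V \<phi>"
  have U: "vectorspace K ?U"
    by (rule perm_module_vectorspace) (rule V.field_axioms)
  interpret U: vectorspace K ?U by fact
  have carr: "f \<in> \<Omega> \<rightarrow> carrier K" "finite {\<omega> \<in> \<Omega>. f \<omega> \<noteq> \<zero>\<^bsub>K\<^esub>}" if "f \<in> carrier ?U" for f
    using that by (auto simp: perm_module_def)
  have "?T f \<in> carrier V" if "f \<in> carrier ?U" for f
    using carr[OF that] assms(2) unfolding perm_lift_def by (intro V.M.finsum_closed) auto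
  moreover have "?T (f \<oplus>\<^bsub>?U\<^esub> h) = ?T f \<oplus>\<^bsub>V\<^esub> ?T h"
    if f: "f \<in> carrier ?U" and h: "h \<in> carrier ?U" for f h
  proof -
    let ?A = "{\<omega> \<in> \<Omega>. f \<omega> \<noteq> \<zero>\<^bsub>K\<^esub>} \<union> {\<omega> \<in> \<Omega>. h \<omega> \<noteq> \<zero>\<^bsub>K\<^esub>}"
    have A: "finite ?A" "?A \<subseteq> \<Omega>" using carr f h by auto
    note cl = carr(1)[OF f] carr(1)[OF h]
    have *: "(f \<oplus>\<^bsub>?U\<^esub> h) \<omega> = f \<omega> \<oplus>\<^bsub>K\<^esub> h \<omega>" if "\<omega> \<in> \<Omega>" for \<omega>
      using that by (simp add: perm_module_def V.func_space_def)
    have "f \<oplus>\<^bsub>?U\<^esub> h \<in> carrier ?U" using f h by blast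
    then have "?T (f \<oplus>\<^bsub>?U\<^esub> h) = (\<Oplus>\<^bsub>V\<^esub>\<omega> \<in> ?A. (f \<oplus>\<^bsub>?U\<^esub> h) \<omega> \<odot>\<^bsub>V\<^esub> \<phi> \<omega>)"
      using A by (intro perm_lift_superset[OF assms] carr) (auto simp: *)
    also have "\<dots> = (\<Oplus>\<^bsub>V\<^esub>\<omega> \<in> ?A. f \<omega> \<odot>\<^bsub>V\<^esub> \<phi> \<omega> \<oplus>\<^bsub>V\<^esub> h \<omega> \<odot>\<^bsub>V\<^esub> \<phi> \<omega>)"
      using cl assms(2) by (intro V.M.finsum_cong') (auto simp: * Pi_iff V.smult_l_distr)
    also have "\<dots> = (\<Oplus>\<^bsub>V\<^esub>\<omega> \<in> ?A. f \<omega> \<odot>\<^bsub>V\<^esub> \<phi> \<omega>) \<oplus>\<^bsub>V\<^esub> (\<Oplus>\<^bsub>V\<^esub>\<omega> \<in> ?A. h \<omega> \<odot>\<^bsub>V\<^esub> \<phi> \<omega>)"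
      using cl assms(2) by (intro V.M.finsum_addf) auto
    also have "\<dots> = ?T f \<oplus>\<^bsub>V\<^esub> ?T h"
      using A by (simp add: perm_lift_superset[OF assms cl(1) A] perm_lift_superset[OF assms cl(2) A])
    finally show ?thesis .
  qed
  moreover have "?T (a \<odot>\<^bsub>?U\<^esub> f) = a \<odot>\<^bsub>V\<^esub> ?T f"
    if a: "a \<in> carrier K" and f: "f \<in> carrier ?U" for a f
  proof -
    let ?A = "{\<omega> \<in> \<Omega>. f \<omega> \<noteq> \<zero>\<^bsub>K\<^esub>}"
    note cl = carr(1)[OF f]
    have *: "(a \<odot>\<^bsub>?U\<^esub> f) \<omega> = a \<otimes>\<^bsub>K\<^esub> f \<omega>" if "\<omega> \<in> \<Omega>" for \<omega>
      using that by (simp add: perm_module_def V.func_space_def)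
    have "a \<odot>\<^bsub>?U\<^esub> f \<in> carrier ?U" using a f by blast
    then have "?T (a \<odot>\<^bsub>?U\<^esub> f) = (\<Oplus>\<^bsub>V\<^esub>\<omega> \<in> ?A. (a \<odot>\<^bsub>?U\<^esub> f) \<omega> \<odot>\<^bsub>V\<^esub> \<phi> \<omega>)"
      using carr(2)[OF f] a f by (intro perm_lift_superset[OF assms] carr) (auto simp: *)
    also have "\<dots> = (\<Oplus>\<^bsub>V\<^esub>\<omega> \<in> ?A. a \<odot>\<^bsub>V\<^esub> (f \<omega> \<odot>\<^bsub>V\<^esub> \<phi> \<omega>))"
      using cl a assms(2) by (intro V.M.finsum_cong') (auto simp: * Pi_iff V.smult_assoc1)
    also have "\<dots> = a \<odot>\<^bsub>V\<^esub> ?T f"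
      unfolding perm_lift_def
      using cl a assms(2) by (intro V.finsum_smult[symmetric]) auto
    finally show ?thesis .
  qed
  ultimately show ?thesis
    using assms(1) U by (auto simp: linear_map_iff module_hom_def)
qed

lemma perm_lift_basis:
  assumes "vectorspace K V" "\<phi> \<in> \<Omega> \<rightarrow> carrier V" "\<omega> \<in> \<Omega>"
  shows "perm_lift K \<Omega> V \<phi> (perm_basis K \<Omega> \<omega>) = \<phi> \<omega>"
proof -
  interpret V: vectorspace K V by fact
  have "perm_lift K \<Omega> V \<phi> (perm_basis K \<Omega> \<omega>) =
      (\<Oplus>\<^bsub>V\<^esub>\<omega>' \<in> {\<omega>}. perm_basis K \<Omega> \<omega> \<omega>' \<odot>\<^bsub>V\<^esub> \<phi> \<omega>')"
    using assms(3) by (intro perm_lift_superset[OF assms(1,2)]) (auto simp: perm_basis_def)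
  also have "\<dots> = \<phi> \<omega>"
    using assms by (subst V.M.finsum_insert) (auto simp: perm_basis_def Pi_iff)
  finally show ?thesis .
qed

lemma
  assumes "group_action G \<Omega> \<alpha>" "g \<in> carrier G" "f \<in> carrier (perm_module K \<Omega>)"
  shows perm_action_closed: "perm_action K G \<Omega> \<alpha> g f \<in> carrier (perm_module K \<Omega>)"
    and perm_action_support: "{\<omega> \<in> \<Omega>. perm_action K G \<Omega> \<alpha> g f \<omega> \<noteq> \<zero>\<^bsub>K\<^esub>} = \<alpha> g ` {\<omega> \<in> \<Omega>. f \<omega> \<noteq> \<zero>\<^bsub>K\<^esub>}"
proof -
  interpret group_action G \<Omega> \<alpha> by fact
  interpret G: group G using group_hom group_hom.axioms(1) by blast
  let ?h = "perm_action K G \<Omega> \<alpha> g f"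
  have h: "?h \<omega> = f (\<alpha> (inv\<^bsub>G\<^esub> g) \<omega>)" if "\<omega> \<in> \<Omega>" for \<omega>
    using assms(3) that by (simp add: perm_action_def)
  have mem: "\<alpha> g \<omega> \<in> \<Omega>" "\<alpha> (inv\<^bsub>G\<^esub> g) \<omega> \<in> \<Omega>" if "\<omega> \<in> \<Omega>" for \<omega>
    using that assms(2) element_image by blast+
  have inv: "\<alpha> (inv\<^bsub>G\<^esub> g) (\<alpha> g \<omega>) = \<omega>" "\<alpha> g (\<alpha> (inv\<^bsub>G\<^esub> g) \<omega>) = \<omega>" if "\<omega> \<in> \<Omega>" for \<omega>
    using that assms(2) orbit_sym_aux by (metis G.inv_closed G.inv_inv)+
  show supp: "{\<omega> \<in> \<Omega>. ?h \<omega> \<noteq> \<zero>\<^bsub>K\<^esub>} = \<alpha> g ` {\<omega> \<in> \<Omega>. f \<omega> \<noteq> \<zero>\<^bsub>K\<^esub>}"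
  proof (intro Set.set_eqI iffI)
    fix \<omega> assume "\<omega> \<in> {\<omega> \<in> \<Omega>. ?h \<omega> \<noteq> \<zero>\<^bsub>K\<^esub>}"
    then show "\<omega> \<in> \<alpha> g ` {\<omega> \<in> \<Omega>. f \<omega> \<noteq> \<zero>\<^bsub>K\<^esub>}"
      using h mem inv by (intro image_eqI[of _ _ "\<alpha> (inv\<^bsub>G\<^esub> g) \<omega>"]) auto
  qed (use h mem inv in auto)
  have "?h \<in> \<Omega> \<rightarrow>\<^sub>E carrier K"
    using assms(3) mem by (auto simp: perm_action_def perm_module_def)
  moreover have "finite {\<omega> \<in> \<Omega>. ?h \<omega> \<noteq> \<zero>\<^bsub>K\<^esub>}"
    using assms(3) unfolding supp by (auto simp: perm_module_def)
  ultimately show "?h \<in> carrier (perm_module K \<Omega>)"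
    by (simp add: perm_module_def)
qed

text \<open>
  The action of \<open>g\<close> moves the support of \<open>f\<close> by \<open>\<alpha> g\<close>, so the sum for the translate of \<open>f\<close> can be
  reindexed along \<open>\<alpha> g\<close>; its summands then are the images of those for \<open>f\<close> under \<open>\<rho> g\<close>.
\<close>

lemma perm_lift_equivariant:
  assumes act: "group_action G \<Omega> \<alpha>" and aff: "affords K G \<Omega> \<alpha> V \<rho> \<phi>"
    and g: "g \<in> carrier G" and f: "f \<in> carrier (perm_module K \<Omega>)"
  shows "perm_lift K \<Omega> V \<phi> (perm_action K G \<Omega> \<alpha> g f) = \<rho> g (perm_lift K \<Omega> V \<phi> f)"
proof -
  interpret group_action G \<Omega> \<alpha> by fact
  interpret G: group G using group_hom group_hom.axioms(1) by blast
  have vs: "vectorspace K V" and \<phi>: "\<phi> \<in> \<Omega> \<rightarrow> carrier V" and \<rho>: "\<rho> \<in> hom G (GL K V)"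
    and eq: "\<And>\<omega>. \<omega> \<in> \<Omega> \<Longrightarrow> \<phi> (\<alpha> g \<omega>) = \<rho> g (\<phi> \<omega>)"
    using aff g by (auto simp: affords_def)
  interpret V: vectorspace K V by fact
  interpret R: linear_map K V V "\<rho> g" by (rule GL_homD(2)[OF G.is_group vs \<rho> g])
  let ?h = "perm_action K G \<Omega> \<alpha> g f" and ?A = "{\<omega> \<in> \<Omega>. f \<omega> \<noteq> \<zero>\<^bsub>K\<^esub>}"
  have fK: "f \<in> \<Omega> \<rightarrow> carrier K"
    using f by (auto simp: perm_module_def)
  have mem: "\<alpha> g \<omega> \<in> \<Omega>" if "\<omega> \<in> \<Omega>" for \<omega>
    using that g element_image by blast
  have h: "?h (\<alpha> g \<omega>) = f \<omega>" if "\<omega> \<in> \<Omega>" for \<omega>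
    using that f g mem orbit_sym_aux[OF g that refl] by (simp add: perm_action_def)
  have cl: "f \<omega> \<in> carrier K" "\<phi> \<omega> \<in> carrier V" "\<rho> g (\<phi> \<omega>) \<in> carrier V" if "\<omega> \<in> \<Omega>" for \<omega>
    using that fK \<phi> by (auto simp: Pi_iff)
  have "perm_lift K \<Omega> V \<phi> ?h = (\<Oplus>\<^bsub>V\<^esub>\<omega> \<in> \<alpha> g ` ?A. ?h \<omega> \<odot>\<^bsub>V\<^esub> \<phi> \<omega>)"
    unfolding perm_lift_def perm_action_support[OF act g f] ..
  also have "\<dots> = (\<Oplus>\<^bsub>V\<^esub>\<omega> \<in> ?A. ?h (\<alpha> g \<omega>) \<odot>\<^bsub>V\<^esub> \<phi> (\<alpha> g \<omega>))"
    using inj_prop[OF g] by (intro V.M.finsum_reindex) (auto simp: h eq cl intro: inj_on_subset)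
  also have "\<dots> = (\<Oplus>\<^bsub>V\<^esub>\<omega> \<in> ?A. \<rho> g (f \<omega> \<odot>\<^bsub>V\<^esub> \<phi> \<omega>))"
    by (intro V.M.finsum_cong') (auto simp: h eq cl)
  also have "\<dots> = \<rho> g (\<Oplus>\<^bsub>V\<^esub>\<omega> \<in> ?A. f \<omega> \<odot>\<^bsub>V\<^esub> \<phi> \<omega>)"
    by (rule R.T_finsum[symmetric]) (auto simp: cl)
  finally show ?thesis by (simp add: perm_lift_def)
qed


section \<open>Minimality forces the lift to be surjective\<close>

text \<open>
  Invariance gives only \<open>\<rho> g ` S \<subseteq> S\<close>.  That \<open>\<rho> g\<close> permutes \<open>S\<close> follows from
  invariance under the inverse of \<open>g\<close>, whose action undoes that of \<open>g\<close>.
\<close>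

lemma affords_invariant_subspace:
  fixes V :: "('k, 'v) module"
  assumes "group G" and aff: "affords K G \<Omega> \<alpha> V \<rho> \<phi>" and S: "subspace K S V"
    and inv: "\<And>g x. g \<in> carrier G \<Longrightarrow> x \<in> S \<Longrightarrow> \<rho> g x \<in> S" and \<phi>S: "\<phi> ` \<Omega> \<subseteq> S"
  shows "affords K G \<Omega> \<alpha> (V\<lparr>carrier := S\<rparr>) (\<lambda>g. restrict (\<rho> g) S) \<phi>"
proof -
  interpret group G by fact
  have vs: "vectorspace K V" and \<rho>: "\<rho> \<in> hom G (GL K V)"
    using aff by (auto simp: affords_def)
  interpret V: vectorspace K V by fact
  have SV: "S \<subseteq> carrier V"
    using S by (auto simp: subspace_def submodule_def)
  have W: "vectorspace K (V\<lparr>carrier := S\<rparr>)"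
    by (rule V.subspace_is_vs[OF S])
  note \<rho>_GL = GL_homD[OF assms(1) vs \<rho>]
  have one: "\<rho> \<one>\<^bsub>G\<^esub> x = x" if "x \<in> S" for x
    using GL_hom_one[OF assms(1) vs \<rho>] that SV by blast
  have mult: "\<rho> (g \<otimes>\<^bsub>G\<^esub> h) x = \<rho> g (\<rho> h x)" if "g \<in> carrier G" "h \<in> carrier G" "x \<in> S" for g h x
    using that SV by (intro \<rho>_GL(3)) auto
  have "bij_betw (\<rho> g) S S" if g: "g \<in> carrier G" for g
  proof (rule bij_betw_byWitness[where f' = "\<rho> (inv\<^bsub>G\<^esub> g)"])
    show "\<forall>x \<in> S. \<rho> (inv\<^bsub>G\<^esub> g) (\<rho> g x) = x" "\<forall>x \<in> S. \<rho> g (\<rho> (inv\<^bsub>G\<^esub> g) x) = x"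
      using g one by (simp_all flip: mult)
    show "\<rho> g ` S \<subseteq> S" "\<rho> (inv\<^bsub>G\<^esub> g) ` S \<subseteq> S"
      using g inv by auto
  qed
  moreover have "restrict (\<rho> g) S \<in> module_hom K (V\<lparr>carrier := S\<rparr>) (V\<lparr>carrier := S\<rparr>)"
    if g: "g \<in> carrier G" for g
  proof -
    have "\<rho> g \<in> module_hom K V V" using \<rho>_GL(2)[OF g] by (simp add: linear_map_iff)
    moreover have "x \<oplus>\<^bsub>V\<^esub> y \<in> S" "a \<odot>\<^bsub>V\<^esub> x \<in> S" if "x \<in> S" "y \<in> S" "a \<in> carrier K" for x y a
      using S that by (auto simp: subspace_def submodule_def)
    ultimately show ?thesis
      using g inv SV by (auto simp: module_hom_def subset_iff)
  qed
  ultimately have "(\<lambda>g. restrict (\<rho> g) S) \<in> hom G (GL K (V\<lparr>carrier := S\<rparr>))"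
    using inv mult by (simp add: in_hom_GL_iff[OF assms(1) W])
  then show ?thesis
    using aff W \<phi>S by (auto simp: affords_def)
qed

text \<open>
  Only spaces of functions from the type of \<open>\<Omega>\<close> to that of \<open>K\<close> compete in \<open>lin_dim\<close>.  Any
  other space can be copied into a given type as soon as its vectors inject into that type: the
  operations on the copy are defined so that the injection becomes linear.
\<close>

lemma affords_transport:
  fixes W :: "('k, 'w) module" and s :: "'w \<Rightarrow> 'q"
  assumes "group G" and aff: "affords K G \<Omega> \<alpha> W \<rho> \<phi>" and inj: "inj_on s (carrier W)"
  obtains Q :: "('k, 'q) module" and \<sigma> \<psi>
  where "linear_map K W Q s" "s ` carrier W = carrier Q" "affords K G \<Omega> \<alpha> Q \<sigma> \<psi>"
proof -
  interpret group G by fact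
  have vs: "vectorspace K W" and \<rho>: "\<rho> \<in> hom G (GL K W)"
    using aff by (auto simp: affords_def)
  interpret W: vectorspace K W by fact
  define t where "t = inv_into (carrier W) s"
  have t[simp]: "t (s x) = x" if "x \<in> carrier W" for x
    using inj that by (simp add: t_def)
  define Q :: "('k, 'q) module" where
    "Q = \<lparr>carrier = s ` carrier W, mult = (\<lambda>x y. s \<zero>\<^bsub>W\<^esub>), one = s \<zero>\<^bsub>W\<^esub>, zero = s \<zero>\<^bsub>W\<^esub>,
      add = (\<lambda>x y. s (t x \<oplus>\<^bsub>W\<^esub> t y)), smult = (\<lambda>a x. s (a \<odot>\<^bsub>W\<^esub> t x))\<rparr>"
  have carr: "s ` carrier W = carrier Q" by (simp add: Q_def)
  have s: "linear_map K W Q s"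
    by (rule linear_image_of_vectorspace[OF vs]) (auto simp: Q_def)
  have t_in: "t y \<in> carrier W" "s (t y) = y" if "y \<in> carrier Q" for y
    using that unfolding carr[symmetric] t_def by (rule inv_into_into, rule f_inv_into_f)
  note \<rho>_GL = GL_homD[OF assms(1) vs \<rho>]
  have cl: "\<rho> g x \<in> carrier W" if "g \<in> carrier G" "x \<in> carrier W" for g x
    using \<rho>_GL(1)[OF that(1)] that(2) by (rule bij_betw_apply)
  define \<sigma> where "\<sigma> g = (\<lambda>y \<in> carrier Q. s (\<rho> g (t y)))" for g
  interpret s: linear_map K W Q s by fact
  have "bij_betw (\<sigma> g) (carrier Q) (carrier Q)" if g: "g \<in> carrier G" for g
  proof -
    have s: "bij_betw s (carrier W) (carrier Q)"
      using inj carr by (rule bij_betw_imageI)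
    have t: "bij_betw t (carrier Q) (carrier W)"
      unfolding t_def by (rule bij_betw_inv_into[OF s])
    have "bij_betw (s \<circ> (\<rho> g \<circ> t)) (carrier Q) (carrier Q)"
      by (rule bij_betw_trans[OF bij_betw_trans[OF t \<rho>_GL(1)[OF g]] s])
    moreover have "bij_betw (s \<circ> (\<rho> g \<circ> t)) (carrier Q) (carrier Q) \<longleftrightarrow>
        bij_betw (\<sigma> g) (carrier Q) (carrier Q)"
      by (rule bij_betw_cong) (simp add: \<sigma>_def)
    ultimately show ?thesis by blast
  qed
  moreover have "\<sigma> g \<in> module_hom K Q Q" if g: "g \<in> carrier G" for g
  proof -
    interpret R: linear_map K W W "\<rho> g" by (rule \<rho>_GL(2)[OF g])
    have \<sigma>_s: "\<sigma> g (s x) = s (\<rho> g x)" if "x \<in> carrier W" for x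
      using that by (simp add: \<sigma>_def)
    have "\<sigma> g (s x \<oplus>\<^bsub>Q\<^esub> s y) = \<sigma> g (s x) \<oplus>\<^bsub>Q\<^esub> \<sigma> g (s y)"
      if "x \<in> carrier W" "y \<in> carrier W" for x y
      using that \<sigma>_s[of "x \<oplus>\<^bsub>W\<^esub> y"] by (simp add: \<sigma>_s)
    moreover have "\<sigma> g (a \<odot>\<^bsub>Q\<^esub> s x) = a \<odot>\<^bsub>Q\<^esub> \<sigma> g (s x)"
      if "a \<in> carrier K" "x \<in> carrier W" for a x
      using that \<sigma>_s[of "a \<odot>\<^bsub>W\<^esub> x"] by (simp add: \<sigma>_s)
    moreover have "\<sigma> g (s x) \<in> carrier Q" if "x \<in> carrier W" for x
      using that by (simp add: \<sigma>_s)
    ultimately show ?thesis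
      unfolding module_hom_def carr[symmetric] by auto
  qed
  moreover have "\<sigma> (g \<otimes>\<^bsub>G\<^esub> h) y = \<sigma> g (\<sigma> h y)"
    if "g \<in> carrier G" "h \<in> carrier G" "y \<in> carrier Q" for g h y
    using that cl t_in \<rho>_GL(3) by (simp add: \<sigma>_def)
  moreover have "\<sigma> g \<in> extensional (carrier Q)" for g
    by (simp add: \<sigma>_def)
  ultimately have "\<sigma> \<in> hom G (GL K Q)"
    by (simp add: in_hom_GL_iff[OF assms(1) s.W.vectorspace_axioms])
  moreover have "inj_on (s \<circ> \<phi>) \<Omega>"
    using aff inj by (auto simp: affords_def intro!: comp_inj_on intro: inj_on_subset)
  ultimately have "affords K G \<Omega> \<alpha> Q \<sigma> (s \<circ> \<phi>)"
    using aff s.W.vectorspace_axioms by (auto simp: affords_def \<sigma>_def Pi_iff)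
  then show thesis using that s carr by blast
qed

lemma lin_dim_le_vdim:
  fixes W :: "('k, 'w) module" and \<Omega> :: "'o set" and s :: "'w \<Rightarrow> 'o \<Rightarrow> 'k"
  assumes "group G" "affords K G \<Omega> \<alpha> W \<rho> \<phi>" and inj: "inj_on s (carrier W)"
    and fd: "vectorspace.fin_dim K W"
  shows "lin_dim K G \<Omega> \<alpha> \<le> vdim K W"
proof -
  obtain Q :: "('k, 'o \<Rightarrow> 'k) module" and \<sigma> \<psi> where Q: "linear_map K W Q s"
    "s ` carrier W = carrier Q" "affords K G \<Omega> \<alpha> Q \<sigma> \<psi>"
    by (rule affords_transport[OF assms(1-3)])
  interpret s: linear_map K W Q s by fact
  have "vdim K Q = vdim K W"
    using fd s.surj_fin_dim[OF fd Q(2)] s.dim_eq[OF fd inj Q(2)] by (simp add: vdim_def)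
  moreover have "lin_dim K G \<Omega> \<alpha> \<le> vdim K Q"
    unfolding lin_dim_def using Q(3) by (intro Inf_lower) blast
  ultimately show ?thesis by simp
qed

text \<open>
  The image \<open>S\<close> of the lift is an invariant subspace through which \<open>\<phi>\<close> factors, so it affords a
  representation itself.  Were \<open>S\<close> proper, its dimension would be smaller than that of \<open>V\<close>, which is
  minimal.  A right inverse of the lift embeds \<open>S\<close> into the functions on \<open>\<Omega>\<close>, so
  \<open>S\<close> does count for the minimum.
\<close>

lemma perm_lift_surj:
  fixes V :: "('k, 'v) module" and \<Omega> :: "'o set"
  assumes act: "group_action G \<Omega> \<alpha>" and aff: "affords K G \<Omega> \<alpha> V \<rho> \<phi>"
    and dim: "vdim K V = lin_dim K G \<Omega> \<alpha>" and fin: "lin_dim K G \<Omega> \<alpha> \<noteq> \<infinity>"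
  shows "perm_lift K \<Omega> V \<phi> ` carrier (perm_module K \<Omega>) = carrier V"
proof (rule ccontr)
  interpret group_action G \<Omega> \<alpha> by fact
  have G: "group G" using group_hom group_hom.axioms(1) by blast
  have vs: "vectorspace K V" and \<phi>: "\<phi> \<in> \<Omega> \<rightarrow> carrier V"
    using aff by (auto simp: affords_def)
  interpret V: vectorspace K V by fact
  let ?U = "perm_module K \<Omega>" and ?T = "perm_lift K \<Omega> V \<phi>"
  define S where "S = ?T ` carrier ?U"
  interpret T: linear_map K ?U V ?T by (rule perm_lift_linear[OF vs \<phi>])
  have S: "subspace K S V"
    using T.imT_is_subspace unfolding T.im_def S_def .
  have inv: "\<rho> g x \<in> S" if "g \<in> carrier G" "x \<in> S" for g x
  proof -
    obtain f where f: "f \<in> carrier ?U" "x = ?T f" using \<open>x \<in> S\<close> by (auto simp: S_def)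
    show ?thesis
      unfolding S_def f(2) perm_lift_equivariant[OF act aff \<open>g \<in> carrier G\<close> f(1), symmetric]
      by (rule imageI) (rule perm_action_closed[OF act \<open>g \<in> carrier G\<close> f(1)])
  qed
  have "\<phi> \<omega> \<in> S" if "\<omega> \<in> \<Omega>" for \<omega>
    unfolding S_def perm_lift_basis[OF vs \<phi> that, symmetric]
    by (rule imageI) (rule perm_basis_closed[OF V.ring_axioms that])
  then have "\<phi> ` \<Omega> \<subseteq> S" by blast
  then have "affords K G \<Omega> \<alpha> (V.vs S) (\<lambda>g. restrict (\<rho> g) S) \<phi>"
    using inv by (intro affords_invariant_subspace[OF G aff S])
  moreover have "inj_on (inv_into (carrier ?U) ?T) (carrier (V.vs S))"
    by (simp add: S_def inj_on_inv_into)
  moreover assume "?T ` carrier ?U \<noteq> carrier V"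
  then have ne: "S \<noteq> carrier V" by (simp add: S_def)
  have fd: "V.fin_dim" using dim fin by (metis vdim_def)
  note less = V.proper_subspace_fin_dim[OF fd S ne]
  ultimately have "lin_dim K G \<Omega> \<alpha> \<le> vdim K (V.vs S)"
    using lin_dim_le_vdim[OF G] less(1) by blast
  also have "\<dots> < vdim K V" using less fd by (simp add: vdim_def)
  finally show False using dim by simp
qed

theorem corollary4p2:
  fixes K :: "('k, 'c) ring_scheme"
    and G :: "('g, 'd) monoid_scheme"
    and \<Omega> :: "'o set"
    and \<alpha> :: "'g \<Rightarrow> 'o \<Rightarrow> 'o"
    and V :: "('k, 'v) module"
    and \<rho> :: "'g \<Rightarrow> 'v \<Rightarrow> 'v"
  assumes "field K"
    and "group_action G \<Omega> \<alpha>"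
    and "lin_dim K G \<Omega> \<alpha> \<noteq> \<infinity>"
    and "witness K G \<Omega> \<alpha> V \<rho>"
  shows "fg_quotient_of K G V \<rho> (perm_module K \<Omega>) (perm_action K G \<Omega> \<alpha>)"
proof -
  obtain \<phi> where aff: "affords K G \<Omega> \<alpha> V \<rho> \<phi>" and dim: "vdim K V = lin_dim K G \<Omega> \<alpha>"
    using assms(4) by (auto simp: witness_def)
  then have vs: "vectorspace K V" and \<phi>: "\<phi> \<in> \<Omega> \<rightarrow> carrier V" and \<rho>: "\<rho> \<in> hom G (GL K V)"
    by (auto simp: affords_def)
  have G: "group G"
    using assms(2) by (simp add: group_action_def group_hom_def)
  have "\<rho> g \<zero>\<^bsub>V\<^esub> = \<zero>\<^bsub>V\<^esub>" if "g \<in> carrier G" for g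
  proof -
    interpret R: linear_map K V V "\<rho> g" by (rule GL_homD(2)[OF G vs \<rho> that])
    show ?thesis by (rule R.f0_is_0)
  qed
  then show ?thesis
  proof (rule fg_quotient_of_surjection[rotated -1])
    show "linear_map K (perm_module K \<Omega>) V (perm_lift K \<Omega> V \<phi>)"
      by (rule perm_lift_linear[OF vs \<phi>])
    show "perm_lift K \<Omega> V \<phi> ` carrier (perm_module K \<Omega>) = carrier V"
      by (rule perm_lift_surj[OF assms(2) aff dim assms(3)])
  qed (use perm_action_closed[OF assms(2)] perm_lift_equivariant[OF assms(2) aff] in auto)
qed

end
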